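(* For any positive integer $k$, $$\mathrm{vex}(n,C_{2k+1})\le \sum_{i=\lceil kn/(2k+1)\rceil-\lceil 2(k+1)\log(2k)\rceil}^{n}\binom{n}{i},$$ where $\log$ is the natural logarithm and $C_{2k+1}$ is the cycle of length $2k+1$. Consequently, for fixed $k$, as $n\to\infty$, $2^n-\mathrm{vex}(n,C_{2k+1})=\Theta_k\left(\sum_{i=0}^{\lfloor kn/(2k+1)\rfloor}\binom{n}{i}\right)$.
   Context: The Kneser cube $Kn_n$ is the graph with vertex set $2^{[n]}=\{F: F\subseteq\{1,\dots,n\}\}$ in which two distinct vertices $F,F'$ are adjacent if and only if $F\cap F'=\emptyset$. For a graph $G$, $\mathrm{vex}(n,G)$ is the maximum size of a family $\mathcal{F}\subseteq 2^{[n]}$ such that the induced subgraph $Kn_n[\mathcal{F}]$ contains no subgraph isomorphic to $G$. $\Theta_k$ means the implied constants may depend on $k$. *)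

theory Defs
  imports Complex_Main "HOL-Library.Landau_Symbols"
begin

record 'a ugraph =
  verts :: "'a set"
  edges :: "'a set set"

definition simple_graph :: "'a ugraph \<Rightarrow> bool" where
  "simple_graph G \<longleftrightarrow> (\<forall>e \<in> edges G. e \<subseteq> verts G \<and> card e = 2)"

definition is_subgraph :: "'a ugraph \<Rightarrow> 'a ugraph \<Rightarrow> bool" where
  "is_subgraph H G \<longleftrightarrow>
     simple_graph H \<and> verts H \<subseteq> verts G \<and> edges H \<subseteq> edges G"

definition induced_subgraph :: "'a ugraph \<Rightarrow> 'a set \<Rightarrow> 'a ugraph" where
  "induced_subgraph G W =
     \<lparr>verts = verts G \<inter> W, edges = {e \<in> edges G. e \<subseteq> W}\<rparr>"

definition graph_iso :: "'a ugraph \<Rightarrow> 'b ugraph \<Rightarrow> bool" where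
  "graph_iso G H \<longleftrightarrow>
     (\<exists>f. bij_betw f (verts G) (verts H) \<and>
          (\<forall>u \<in> verts G. \<forall>v \<in> verts G. {u, v} \<in> edges G \<longleftrightarrow> {f u, f v} \<in> edges H))"

definition contains_copy :: "'a ugraph \<Rightarrow> 'b ugraph \<Rightarrow> bool" where
  "contains_copy G H \<longleftrightarrow> (\<exists>K. is_subgraph K G \<and> graph_iso K H)"

text \<open>The cycle of length m; meaningful for m at least 3.\<close>

definition cycle_graph :: "nat \<Rightarrow> nat ugraph" where
  "cycle_graph m =
     \<lparr>verts = {0..<m}, edges = {{i, (i + 1) mod m} | i. i < m}\<rparr>"

definition kneser_cube :: "nat \<Rightarrow> nat set ugraph" where
  "kneser_cube n =
     \<lparr>verts = Pow {1..n},
      edges = {{F, F'} | F F'. F \<subseteq> {1..n} \<and> F' \<subseteq> {1..n} \<and> F \<noteq> F' \<and> F \<inter> F' = {}}\<rparr>"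

definition vex :: "nat \<Rightarrow> 'a ugraph \<Rightarrow> nat" where
  "vex n G = Max {card \<F> | \<F>. \<F> \<subseteq> Pow {1..n} \<and>
       \<not> contains_copy (induced_subgraph (kneser_cube n) \<F>) G}"

lemma simple_graph_kneser_cube: "simple_graph (kneser_cube n)"
  unfolding simple_graph_def
proof
  fix e assume "e \<in> edges (kneser_cube n)"
  then obtain F F' where e: "e = {F, F'}" "F \<subseteq> {1..n}" "F' \<subseteq> {1..n}" "F \<noteq> F'"
    by (auto simp only: kneser_cube_def ugraph.simps mem_Collect_eq)
  show "e \<subseteq> verts (kneser_cube n) \<and> card e = 2"
  proof
    show "e \<subseteq> verts (kneser_cube n)"
      using e(2,3) by (simp add: e(1) kneser_cube_def)
    show "card e = 2"
      unfolding e(1) using e(4) by (rule card_2_iff[THEN iffD2, OF exI, OF exI, OF conjI, OF refl])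
  qed
qed

lemma simple_graph_cycle_graph:
  assumes "m \<ge> 3"
  shows "simple_graph (cycle_graph m)"
  unfolding simple_graph_def
proof
  fix e assume "e \<in> edges (cycle_graph m)"
  then obtain i where e: "e = {i, (i + 1) mod m}" and i: "i < m"
    by (auto simp only: cycle_graph_def ugraph.simps mem_Collect_eq)
  have "i \<noteq> (i + 1) mod m"
    using i assms by (cases "i + 1 = m") simp_all
  then show "e \<subseteq> verts (cycle_graph m) \<and> card e = 2"
    using i by (simp add: e cycle_graph_def)
qed

text \<open>The maximum in the definition of vex is taken over a finite set, which is
  nonempty whenever the forbidden graph has a vertex.\<close>

lemma finite_vex_set:
  "finite {card \<F> | \<F>. \<F> \<subseteq> Pow {1..n} \<and>
       \<not> contains_copy (induced_subgraph (kneser_cube n) \<F>) G}"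
proof (rule finite_subset)
  show "{card \<F> | \<F>. \<F> \<subseteq> Pow {1..n} \<and>
       \<not> contains_copy (induced_subgraph (kneser_cube n) \<F>) G} \<subseteq> card ` Pow (Pow {1..n})"
    by blast
  show "finite (card ` Pow (Pow {1..n}))"
    by (intro finite_imageI) simp
qed

lemma vex_set_nonempty:
  assumes "verts G \<noteq> {}"
  shows "{card \<F> | \<F>. \<F> \<subseteq> Pow {1..n} \<and>
       \<not> contains_copy (induced_subgraph (kneser_cube n) \<F>) G} \<noteq> {}"
proof -
  have "\<not> contains_copy (induced_subgraph (kneser_cube n) {}) G"
    using assms
    by (auto simp: contains_copy_def graph_iso_def is_subgraph_def induced_subgraph_def
        bij_betw_def)
  then show ?thesis
    by blast
qed

end

theory Submission
  imports Defs "HOL-Combinatorics.Permutations" "HOL-Number_Theory.Cong"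
begin

text \<open>Let \<open>m = 2 * k + 1\<close> and \<open>T = k * n div m\<close>. Place \<open>[n]\<close> on a circle and let \<open>m\<close> arcs of length
  \<open>a \<le> T\<close> start at the positions \<open>i * k * n div m\<close>. Consecutive arcs are disjoint, and the sequence
  closes up after \<open>k\<close> turns. Under every permutation of the circle a family without a cycle of
  length \<open>m\<close> misses one of these arcs, so a union bound shows that it misses at least a fraction
  \<open>1 / m\<close> of each level \<open>a\<close> with \<open>1 \<le> a \<le> T\<close>. Up to level \<open>T\<close> the binomial coefficients grow at least
  by the factor \<open>(k + 1) / k\<close>, so going down \<open>\<lceil>2 (k + 1) ln (2 k)\<rceil>\<close> levels costs a factor
  \<open>(2 k)\<^sup>2 \<ge> m\<close>, which absorbs the loss \<open>m\<close> of the union bound. Conversely, each point lies in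
  at most \<open>k\<close> sets of an \<open>m\<close>-cycle, so one of its sets has size at most \<open>T\<close>, and the family of
  all larger sets is free of such cycles.\<close>

subsection \<open>Cycles in the Kneser cube\<close>

text \<open>The copy need not be induced: \<open>K\<close> carries only the images of the cycle
  edges, so further disjoint pairs among the \<open>f i\<close> do no harm.\<close>

lemma contains_copy_cycleI:
  assumes m: "m \<ge> 3" and F: "\<F> \<subseteq> Pow {1..n}"
    and inj: "inj_on f {0..<m}" and mem: "\<And>i. i < m \<Longrightarrow> f i \<in> \<F>"
    and disj: "\<And>i. i < m \<Longrightarrow> f i \<inter> f ((i + 1) mod m) = {}"
  shows "contains_copy (induced_subgraph (kneser_cube n) \<F>) (cycle_graph m)"
proof -
  let ?C = "cycle_graph m"
  define K where "K = \<lparr>verts = f ` {0..<m}, edges = (`) f ` edges ?C\<rparr>"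
  have simp_C: "e \<subseteq> {0..<m} \<and> card e = 2" if "e \<in> edges ?C" for e
    using simple_graph_cycle_graph[OF m] that by (auto simp: simple_graph_def cycle_graph_def)
  have "simple_graph K"
    unfolding simple_graph_def
  proof
    fix e assume "e \<in> edges K"
    then obtain d where d: "e = f ` d" "d \<in> edges ?C" by (auto simp: K_def)
    then have "card e = card d"
      using simp_C inj by (metis card_image inj_on_subset)
    then show "e \<subseteq> verts K \<and> card e = 2" using simp_C[OF d(2)] d by (auto simp: K_def)
  qed
  moreover have sub: "f ` {0..<m} \<subseteq> \<F>" using mem by auto
  have "verts K \<subseteq> verts (induced_subgraph (kneser_cube n) \<F>)"
    using sub order_trans[OF sub F] by (simp add: K_def induced_subgraph_def kneser_cube_def)
  moreover have "edges K \<subseteq> edges (induced_subgraph (kneser_cube n) \<F>)"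
  proof
    fix e assume "e \<in> edges K"
    then obtain i where i: "i < m" "e = {f i, f ((i + 1) mod m)}"
      by (auto simp: K_def cycle_graph_def)
    have i': "(i + 1) mod m < m" using m by simp
    have "i \<noteq> (i + 1) mod m" using i m by (cases "i + 1 = m") simp_all
    then have "f i \<noteq> f ((i + 1) mod m)" using inj i(1) i' by (auto simp: inj_on_def)
    moreover have eF: "f i \<in> \<F>" "f ((i + 1) mod m) \<in> \<F>" using mem i(1) i' by blast+
    then have "f i \<subseteq> {1..n}" "f ((i + 1) mod m) \<subseteq> {1..n}" using F by blast+
    ultimately have "e \<in> edges (kneser_cube n)"
      using disj[OF i(1)] i(2) unfolding kneser_cube_def ugraph.simps mem_Collect_eq by blast
    then show "e \<in> edges (induced_subgraph (kneser_cube n) \<F>)"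
      using eF i(2) by (simp add: induced_subgraph_def)
  qed
  moreover have "graph_iso K ?C"
    unfolding graph_iso_def
  proof (intro exI conjI ballI)
    show "bij_betw (inv_into {0..<m} f) (verts K) (verts ?C)"
      using inj by (simp add: K_def cycle_graph_def bij_betw_inv_into inj_on_imp_bij_betw)
    fix u v assume "u \<in> verts K" "v \<in> verts K"
    then obtain x y where xy: "u = f x" "v = f y" "x \<in> {0..<m}" "y \<in> {0..<m}"
      by (auto simp: K_def)
    \<comment> \<open>Taking images under \<open>f\<close> is injective on subsets of
      \<open>{0..<m}\<close>, so an edge of \<open>K\<close> comes from exactly one edge of the
      cycle.\<close>
    have "f ` {x, y} \<in> (`) f ` edges ?C \<longleftrightarrow> {x, y} \<in> edges ?C"
    proof
      assume "f ` {x, y} \<in> (`) f ` edges ?C"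
      then obtain d where d: "f ` {x, y} = f ` d" "d \<in> edges ?C" by blast
      have "{x, y} = d"
        using inj_on_image_eq_iff[OF inj, of "{x, y}" d] d simp_C[OF d(2)] xy by simp
      then show "{x, y} \<in> edges ?C" using d by simp
    qed blast
    then show "{u, v} \<in> edges K \<longleftrightarrow>
        {inv_into {0..<m} f u, inv_into {0..<m} f v} \<in> edges ?C"
      using xy inj by (simp add: K_def)
  qed
  ultimately show ?thesis unfolding contains_copy_def is_subgraph_def by blast
qed

lemma contains_copy_cycleE:
  assumes "contains_copy (induced_subgraph (kneser_cube n) \<F>) (cycle_graph m)"
  obtains f where "\<And>i. i < m \<Longrightarrow> f i \<in> \<F>" "\<And>i. i < m \<Longrightarrow> f i \<subseteq> {1..n}"
    "\<And>i. i < m \<Longrightarrow> f i \<inter> f ((i + 1) mod m) = {}"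
proof -
  from assms obtain K g where K: "is_subgraph K (induced_subgraph (kneser_cube n) \<F>)"
    and bij: "bij_betw g (verts K) (verts (cycle_graph m))"
    and iso: "\<forall>u\<in>verts K. \<forall>v\<in>verts K.
      {u, v} \<in> edges K \<longleftrightarrow> {g u, g v} \<in> edges (cycle_graph m)"
    by (auto simp: contains_copy_def graph_iso_def)
  have bij': "bij_betw g (verts K) {0..<m}" using bij by (simp add: cycle_graph_def)
  define f where "f = inv_into (verts K) g"
  have gf: "g (f i) = i" and fK: "f i \<in> verts K" if "i < m" for i
    using bij' that by (auto simp: f_def bij_betw_def f_inv_into_f inv_into_into)
  have sub: "f i \<in> \<F> \<and> f i \<subseteq> {1..n}" if "i < m" for i
    using fK[OF that] K by (auto simp: is_subgraph_def induced_subgraph_def kneser_cube_def)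
  have "f i \<inter> f ((i + 1) mod m) = {}" if i: "i < m" for i
  proof -
    have i': "(i + 1) mod m < m" using i by simp
    have "{i, (i + 1) mod m} \<in> edges (cycle_graph m)" using i by (auto simp: cycle_graph_def)
    then have "{f i, f ((i + 1) mod m)} \<in> edges K"
      using iso fK[OF i] fK[OF i'] gf[OF i] gf[OF i'] by simp
    then have "{f i, f ((i + 1) mod m)} \<in> edges (kneser_cube n)"
      using K by (auto simp: is_subgraph_def induced_subgraph_def)
    then show ?thesis by (auto simp: kneser_cube_def doubleton_eq_iff)
  qed
  with sub show ?thesis using that by blast
qed

text \<open>\<open>I\<close> and its shift by one are disjoint and equally large among
  \<open>2 * k + 1\<close> residues, hence \<open>2 * card I \<le> 2 * k + 1\<close>.\<close>

lemma card_independent_odd_cycle: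
  assumes "I \<subseteq> {0..<2 * k + 1}"
    and "\<And>i. i \<in> I \<Longrightarrow> (i + 1) mod (2 * k + 1) \<notin> I"
  shows "card I \<le> k"
proof -
  let ?m = "2 * k + 1"
  let ?h = "\<lambda>i. (i + 1) mod ?m"
  have "inj_on ?h {0..<?m}"
  proof (rule inj_onI)
    fix x y assume "x \<in> {0..<?m}" "y \<in> {0..<?m}" "?h x = ?h y"
    then have "[x + 1 = y + 1] (mod ?m)" by (simp only: cong_def)
    then have "[x = y] (mod ?m)" using cong_add_rcancel_nat by blast
    then show "x = y" using \<open>x \<in> _\<close> \<open>y \<in> _\<close> by (simp add: cong_def)
  qed
  then have "card (?h ` I) = card I" using assms(1) by (meson card_image inj_on_subset)
  moreover have "card (I \<union> ?h ` I) = card I + card (?h ` I)"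
    using assms finite_subset[OF assms(1)] by (intro card_Un_disjoint) auto
  moreover have "card (I \<union> ?h ` I) \<le> card {0..<?m}"
    using assms(1) by (intro card_mono) auto
  ultimately show ?thesis by simp
qed

text \<open>Double counting of the pairs \<open>(i, x)\<close> with \<open>x \<in> f i\<close>: the
  indices of the sets through a fixed \<open>x\<close> are independent in the cycle, so there are at
  most \<open>k * n\<close> pairs, fewer than if every set exceeded the average.\<close>

lemma odd_cycle_has_small_set:
  assumes sub: "\<And>i. i < 2 * k + 1 \<Longrightarrow> f i \<subseteq> {1..n}"
    and disj: "\<And>i. i < 2 * k + 1 \<Longrightarrow> f i \<inter> f ((i + 1) mod (2 * k + 1)) = {}"
  shows "\<exists>i < 2 * k + 1. card (f i) \<le> k * n div (2 * k + 1)"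
proof (rule ccontr)
  let ?m = "2 * k + 1"
  assume "\<not> ?thesis"
  then have big: "k * n div ?m + 1 \<le> card (f i)" if "i < ?m" for i using that by force
  have "k * n < ?m * (k * n div ?m + 1)"
    using dividend_less_times_div[of ?m "k * n"] by simp
  also have "\<dots> = (\<Sum>i<?m. k * n div ?m + 1)" by simp
  also have "\<dots> \<le> (\<Sum>i<?m. card (f i))" by (rule sum_mono) (use big in auto)
  also have "\<dots> = (\<Sum>i<?m. \<Sum>x\<in>{1..n}. if x \<in> f i then 1 else 0)"
  proof (rule sum.cong)
    fix i assume "i \<in> {..<?m}"
    then have "{1..n} \<inter> {x. x \<in> f i} = f i" using sub[of i] by auto
    then show "card (f i) = (\<Sum>x\<in>{1..n}. if x \<in> f i then 1 else 0)"
      by (simp add: sum.If_cases)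
  qed simp
  also have "\<dots> = (\<Sum>x\<in>{1..n}. \<Sum>i<?m. if x \<in> f i then 1 else 0)" by (rule sum.swap)
  also have "\<dots> \<le> (\<Sum>x\<in>{1..n}. k)"
  proof (rule sum_mono)
    fix x
    have "card {i. i < ?m \<and> x \<in> f i} \<le> k"
      using disj by (intro card_independent_odd_cycle) auto
    then show "(\<Sum>i<?m. if x \<in> f i then 1 else 0) \<le> k"
      by (simp add: sum.If_cases lessThan_def Collect_conj_eq)
  qed
  also have "\<dots> = k * n" by simp
  finally show False by simp
qed

subsection \<open>Cyclic arcs\<close>

text \<open>\<open>Suc\<close> maps residues to the ground set \<open>{1..n}\<close>. The start
  \<open>s\<close> is not reduced modulo \<open>n\<close>, so that positions can be compared on the
  unrolled line.\<close>

definition arc :: "nat \<Rightarrow> nat \<Rightarrow> nat \<Rightarrow> nat set" where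
  "arc n s l = (\<lambda>j. Suc ((s + j) mod n)) ` {..<l}"

lemma arc_subset: "0 < n \<Longrightarrow> arc n s l \<subseteq> {1..n}"
  by (auto simp: arc_def Suc_le_eq)

lemma card_arc:
  assumes "l \<le> n"
  shows "card (arc n s l) = l"
proof -
  have "inj_on (\<lambda>j. Suc ((s + j) mod n)) {..<l}"
  proof (rule inj_onI)
    fix x y assume "x \<in> {..<l}" "y \<in> {..<l}" "Suc ((s + x) mod n) = Suc ((s + y) mod n)"
    then have "[x = y] (mod n)" using cong_add_lcancel_nat by (auto simp: cong_def)
    then show "x = y" using \<open>x \<in> _\<close> \<open>y \<in> _\<close> assms by (simp add: cong_def)
  qed
  then show ?thesis by (simp add: arc_def card_image)
qed

lemma arc_cong: "s mod n = s' mod n \<Longrightarrow> arc n s l = arc n s' l"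
  unfolding arc_def by (metis mod_add_cong)

text \<open>On the unrolled line both arcs lie, one after the other, in the window from
  \<open>s\<close> to \<open>s + n\<close>, where residues do not repeat.\<close>

lemma arc_disjoint:
  assumes "s + l \<le> s'" "s' + l' \<le> s + n"
  shows "arc n s l \<inter> arc n s' l' = {}"
proof (rule ccontr)
  assume "\<not> ?thesis"
  then obtain i j where ij: "i < l" "j < l'" "(s + i) mod n = (s' + j) mod n"
    by (auto simp: arc_def)
  have "s + i \<le> s' + j" using ij assms by linarith
  then have "n dvd (s' + j) - (s + i)" using mod_eq_dvd_iff_nat ij(3) by metis
  moreover have "0 < (s' + j) - (s + i)" "(s' + j) - (s + i) < n" using ij assms by linarith+
  ultimately show False by (meson nat_dvd_not_less)
qed

text \<open>In an arc that is neither empty nor the whole circle, only the first point has its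
  predecessor outside the arc.\<close>

lemma arc_eq_imp_start:
  assumes eq: "arc n s l = arc n s' l'" and l: "0 < l" "l < n"
  shows "s mod n = s' mod n"
proof -
  have "Suc (s mod n) \<in> arc n s l" using l by (force simp: arc_def)
  then obtain j where j: "j < l'" "s mod n = (s' + j) mod n" unfolding eq by (auto simp: arc_def)
  show ?thesis
  proof (cases j)
    case (Suc j')
    then have "Suc ((s' + j') mod n) \<in> arc n s l" unfolding eq using j(1) by (auto simp: arc_def)
    then obtain i where i: "i < l" "(s' + j') mod n = (s + i) mod n" by (auto simp: arc_def)
    have "s mod n = Suc ((s' + j') mod n) mod n" using j(2) Suc by (simp add: mod_Suc_eq)
    also have "\<dots> = (s + Suc i) mod n" by (simp add: i(2) mod_Suc_eq)
    finally have "s mod n = (s + Suc i) mod n" .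
    then have "[s + Suc i = s + 0] (mod n)" by (simp add: cong_def)
    then have "[Suc i = 0] (mod n)" using cong_add_lcancel_nat by blast
    \<comment> \<open>Contradiction, since \<open>0 < Suc i \<le> l < n\<close>.\<close>
    then show ?thesis using i(1) l by (simp add: cong_def)
  qed (use j in simp)
qed

text \<open>The residue \<open>i * k mod m\<close> is the place of the \<open>i\<close>-th starting point around the circle.\<close>

lemma start_mod:
  fixes i k n m :: nat
  assumes "0 < m" "0 < n"
  shows "(i * k * n div m) mod n = (i * k mod m) * n div m"
proof -
  let ?q = "i * k div m" and ?r = "i * k mod m"
  have "i * k * n = (?q * m + ?r) * n" by (simp only: div_mult_mod_eq)
  also have "\<dots> = ?r * n + ?q * n * m" by (simp only: distrib_right) (simp only: ac_simps)
  finally have "i * k * n div m = ?q * n + ?r * n div m" using assms by simp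
  moreover have "?r * n div m < n" using assms by (simp add: div_less_iff_less_mult mult.commute)
  ultimately show ?thesis by simp
qed

text \<open>As \<open>m \<le> n\<close>, raising \<open>r\<close> by one raises \<open>r * n\<close>
  by at least \<open>m\<close>, so the quotient grows by at least one.\<close>

lemma div_scale_inj:
  fixes r r' n m :: nat
  assumes "0 < m" "m \<le> n" "r * n div m = r' * n div m"
  shows "r = r'"
proof -
  have less: "r * n div m < r' * n div m" if "r < r'" for r r' :: nat
  proof -
    have "r * n + m \<le> Suc r * n" using assms(2) by simp
    also have "\<dots> \<le> r' * n" using that by (intro mult_right_mono) auto
    finally have "(r * n + m) div m \<le> r' * n div m" by (rule div_le_mono)
    then show ?thesis using assms(1) by simp
  qed
  show ?thesis using less[of r r'] less[of r' r] assms(3) by (metis less_irrefl nat_neq_iff)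
qed

text \<open>Multiplication by \<open>k\<close> permutes the residues modulo
  \<open>2 * k + 1\<close>, because a common divisor of \<open>k\<close> and
  \<open>2 * k + 1\<close> divides 1. Distinct residues give distinct positions by
  \<open>div_scale_inj\<close>.\<close>

lemma start_inj:
  fixes i j k n :: nat
  assumes "2 * k + 1 \<le> n" "i < 2 * k + 1" "j < 2 * k + 1"
    and "(i * k * n div (2 * k + 1)) mod n = (j * k * n div (2 * k + 1)) mod n"
  shows "i = j"
proof -
  have "(i * k mod (2 * k + 1)) = (j * k mod (2 * k + 1))"
  proof (rule div_scale_inj)
    show "0 < 2 * k + 1" "2 * k + 1 \<le> n" using assms(1) by simp_all
    then have "0 < n" by linarith
    then show "(i * k mod (2 * k + 1)) * n div (2 * k + 1) = (j * k mod (2 * k + 1)) * n div (2 * k + 1)"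
      using assms(4) by (simp only: start_mod[OF \<open>0 < 2 * k + 1\<close>])
  qed
  moreover have "coprime k (2 * k + 1)"
    by (rule coprimeI) (use dvd_add_right_iff dvd_mult in blast)
  ultimately have "[i = j] (mod (2 * k + 1))"
    using cong_mult_rcancel_nat by (auto simp: cong_def)
  then show ?thesis using assms by (simp add: cong_def)
qed

lemma start_step:
  fixes i k n m :: nat
  shows "i * k * n div m + k * n div m \<le> Suc i * k * n div m"
  using div_add1_eq[of "i * k * n" "k * n" m] by (simp add: algebra_simps)

text \<open>Two steps advance by \<open>2 * k * n / (2 * k + 1)\<close>, less than a full turn, so
  arcs \<open>i\<close> and \<open>i + 1\<close> fit into one window of length
  \<open>n\<close>.\<close>

lemma start_two_steps:
  fixes i k n :: nat
  shows "Suc (Suc i) * k * n div (2 * k + 1) \<le> i * k * n div (2 * k + 1) + n"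
proof -
  have "Suc (Suc i) * k * n \<le> i * k * n + n * (2 * k + 1)" by (simp add: algebra_simps)
  then have "Suc (Suc i) * k * n div (2 * k + 1) \<le> (i * k * n + n * (2 * k + 1)) div (2 * k + 1)"
    by (rule div_le_mono)
  also have "\<dots> = i * k * n div (2 * k + 1) + n" using div_mult_self1[of "2 * k + 1" "i * k * n" n] by simp
  finally show ?thesis .
qed

lemma consecutive_arcs_disjoint:
  fixes k n :: nat
  defines "m \<equiv> 2 * k + 1"
  assumes i: "i < m" and l: "l \<le> k * n div m" "l' \<le> k * n div m"
  shows "arc n (i * k * n div m) l \<inter> arc n (((i + 1) mod m) * k * n div m) l' = {}"
proof -
  have "arc n (((i + 1) mod m) * k * n div m) l' = arc n (Suc i * k * n div m) l'"
  proof (cases "Suc i = m")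
    case True
    \<comment> \<open>From the last arc back to the first: \<open>m\<close> steps add up to exactly
      \<open>k * n\<close>, that is, \<open>k\<close> full turns.\<close>
    have "Suc i * k * n div m = m * (k * n) div m" by (simp only: True mult.assoc)
    also have "\<dots> = k * n" by (rule nonzero_mult_div_cancel_left) (simp add: m_def)
    finally have "Suc i * k * n div m = k * n" .
    then show ?thesis using True by (intro arc_cong) simp
  qed (use i in simp)
  moreover have "arc n (i * k * n div m) l \<inter> arc n (Suc i * k * n div m) l' = {}"
    using start_step[of i k n m] start_step[of "Suc i" k n m] start_two_steps[of i k n] l
    unfolding m_def by (intro arc_disjoint) linarith+
  ultimately show ?thesis by simp
qed

subsection \<open>Averaging over permutations\<close>

lemma ex_permutes_image:
  assumes "finite A" "S \<subseteq> A" "S' \<subseteq> A" "card S = card S'"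
  obtains p where "p permutes A" "p ` S = S'"
proof -
  have fin: "finite S" "finite S'" using assms finite_subset by blast+
  obtain g where g: "bij_betw g S S'" using assms(4) fin by (metis finite_same_card_bij)
  have "card (A - S) = card (A - S')" using assms fin by (simp add: card_Diff_subset)
  then obtain h where h: "bij_betw h (A - S) (A - S')"
    using assms(1) by (metis finite_same_card_bij finite_Diff)
  define p where "p x = (if x \<in> S then g x else if x \<in> A then h x else x)" for x
  have pS: "bij_betw p S S'" using g by (rule bij_betw_cong[THEN iffD1, rotated]) (simp add: p_def)
  have pA: "bij_betw p (A - S) (A - S')"
    using h by (rule bij_betw_cong[THEN iffD1, rotated]) (simp add: p_def)
  have "bij_betw p (S \<union> (A - S)) (S' \<union> (A - S'))"
    using pS pA by (rule bij_betw_combine) blast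
  then have "bij_betw p A A" using assms by (simp add: Un_absorb1)
  then have "p permutes A" using assms(2) by (intro bij_imp_permutes) (auto simp: p_def)
  with pS show ?thesis using that by (auto simp: bij_betw_def)
qed

lemma card_permutes_image_level:
  assumes A: "finite A" and B: "B \<subseteq> A"
    and G: "\<G> \<subseteq> {S. S \<subseteq> A \<and> card S = card B}"
  shows "card {p. p permutes A \<and> p ` B \<in> \<G>} * (card A choose card B) = card \<G> * fact (card A)"
proof -
  let ?L = "{S. S \<subseteq> A \<and> card S = card B}"
  let ?P = "\<lambda>S. {p. p permutes A \<and> p ` B = S}"
  have finP: "finite (?P S)" for S
    using finite_permutations[OF A] by (rule finite_subset[rotated]) blast
  have finL: "finite ?L" using A by simp
  \<comment> \<open>Composition with a permutation that carries \<open>S\<close> to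
    \<open>S'\<close> injects one fibre into the other; exchanging the roles gives equality.\<close>
  have le: "card (?P S) \<le> card (?P S')" if "S \<in> ?L" "S' \<in> ?L" for S S'
  proof -
    obtain q where q: "q permutes A" "q ` S = S'"
      using ex_permutes_image[OF A, of S S'] \<open>S \<in> ?L\<close> \<open>S' \<in> ?L\<close> by auto
    have "inj_on ((\<circ>) q) (?P S)" using permutes_inj[OF q(1)] by (auto simp: inj_on_def fun.inj_map_strong fun_eq_iff)
    moreover have "(\<circ>) q ` ?P S \<subseteq> ?P S'"
      using q permutes_compose by (auto simp: image_comp[symmetric])
    ultimately show ?thesis using finP by (rule card_inj_on_le)
  qed
  have const: "card (?P S) = card (?P B)" if "S \<in> ?L" for S
    using le[of S B] le[of B S] that B by auto
  \<comment> \<open>Applied twice: the whole level determines the common fibre size, and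
    \<open>\<G>\<close> then gives the claim.\<close>
  have count: "card {p. p permutes A \<and> p ` B \<in> \<H>} = card \<H> * card (?P B)" if "\<H> \<subseteq> ?L" for \<H>
  proof -
    have "{p. p permutes A \<and> p ` B \<in> \<H>} = (\<Union>S\<in>\<H>. ?P S)" by blast
    also have "card \<dots> = (\<Sum>S\<in>\<H>. card (?P S))"
      using finite_subset[OF that finL] finP by (intro card_UN_disjoint) auto
    also have "\<dots> = (\<Sum>S\<in>\<H>. card (?P B))" by (rule sum.cong) (use const that in auto)
    finally show ?thesis by simp
  qed
  have "{p. p permutes A \<and> p ` B \<in> ?L} = {p. p permutes A}"
  proof (intro Collect_cong iffI conjI)
    fix p assume p: "p permutes A"
    have "p ` B \<subseteq> A" using image_mono[OF B, of p] permutes_image[OF p] by simp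
    moreover have "card (p ` B) = card B" by (rule card_image[OF permutes_inj_on[OF p]])
    ultimately show "p ` B \<in> ?L" by simp
  qed auto
  then have "(card A choose card B) * card (?P B) = fact (card A)"
    using count[of ?L] card_permutations[OF refl A] n_subsets[OF A] by simp
  with count[OF G] show ?thesis by (simp add: algebra_simps)
qed

text \<open>If some permutation put all \<open>m\<close> arcs into \<open>\<F>\<close>, their images
  would form a cycle. So the events \<open>?Q i\<close> cover all permutations, and each has
  probability \<open>card ?G / (n choose a)\<close>.\<close>

lemma cycle_free_misses_level:
  fixes k n a :: nat
  defines "m \<equiv> 2 * k + 1"
  assumes k: "k \<ge> 1" and n: "m \<le> n" and F: "\<F> \<subseteq> Pow {1..n}"
    and free: "\<not> contains_copy (induced_subgraph (kneser_cube n) \<F>) (cycle_graph m)"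
    and a: "1 \<le> a" "a \<le> k * n div m"
  shows "n choose a \<le> m * card {S \<in> Pow {1..n} - \<F>. card S = a}"
proof -
  let ?G = "{S \<in> Pow {1..n} - \<F>. card S = a}"
  let ?arc = "\<lambda>i. arc n (i * k * n div m) a"
  let ?Q = "\<lambda>i. {p. p permutes {1..n} \<and> p ` ?arc i \<in> ?G}"
  have n0: "0 < n" using n by (simp add: m_def)
  have "k * n div m < n" using n0 by (simp add: m_def div_less_iff_less_mult)
  then have an: "a < n" using a by simp
  have "{p. p permutes {1..n}} \<subseteq> (\<Union>i<m. ?Q i)"
  proof (rule ccontr)
    assume "\<not> ?thesis"
    then obtain p where p: "p permutes {1..n}" "\<And>i. i < m \<Longrightarrow> p ` ?arc i \<notin> ?G" by blast
    have injp: "inj p" using p(1) by (rule permutes_inj)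
    have mem: "p ` ?arc i \<in> \<F>" if "i < m" for i
    proof -
      have "p ` ?arc i \<subseteq> {1..n}"
        using image_mono[OF arc_subset[OF n0]] permutes_image[OF p(1)] by metis
      moreover have "card (p ` ?arc i) = a"
        using injp an by (simp add: card_image inj_on_subset card_arc)
      ultimately show ?thesis using p(2)[OF that] by blast
    qed
    have "contains_copy (induced_subgraph (kneser_cube n) \<F>) (cycle_graph m)"
    proof (rule contains_copy_cycleI[where f = "\<lambda>i. p ` ?arc i"])
      \<comment> \<open>The bounds \<open>0 < a < n\<close> let an arc determine its start, and
        \<open>m \<le> n\<close> keeps the starts distinct.\<close>
      show "inj_on (\<lambda>i. p ` ?arc i) {0..<m}"
      proof (rule inj_onI)
        fix i j assume ij: "i \<in> {0..<m}" "j \<in> {0..<m}" "p ` ?arc i = p ` ?arc j"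
        then have "?arc i = ?arc j" using injp by (simp add: inj_image_eq_iff)
        then have "(i * k * n div m) mod n = (j * k * n div m) mod n"
          using arc_eq_imp_start a(1) an by simp
        then show "i = j" using start_inj ij n unfolding m_def by simp
      qed
      show "p ` ?arc i \<inter> p ` ?arc ((i + 1) mod m) = {}" if "i < m" for i
        using consecutive_arcs_disjoint[of i k a n a] that a(2) injp
        unfolding m_def by (simp flip: image_Int)
    qed (use k F mem in \<open>auto simp: m_def\<close>)
    with free show False by contradiction
  qed
  moreover have finQ: "finite (?Q i)" for i
    by (rule finite_subset[OF _ finite_permutations[of "{1..n}"]]) auto
  ultimately have "card {p. p permutes {1..n}} \<le> card (\<Union>i<m. ?Q i)"
    by (intro card_mono) auto
  also have "\<dots> \<le> (\<Sum>i<m. card (?Q i))" by (rule card_UN_le) simp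
  finally have "fact n \<le> (\<Sum>i<m. card (?Q i))"
    using card_permutations[of "{1..n}" n] by simp
  then have "fact n * (n choose a) \<le> (\<Sum>i<m. card (?Q i)) * (n choose a)" by (rule mult_right_mono) simp
  also have "\<dots> = (\<Sum>i<m. card (?Q i) * (n choose a))" by (rule sum_distrib_right)
  also have "\<dots> = (\<Sum>i<m. card ?G * fact n)"
  proof (rule sum.cong)
    fix i
    have "card (?arc i) = a" using an by (simp add: card_arc)
    then show "card (?Q i) * (n choose a) = card ?G * fact n"
      using card_permutes_image_level[of "{1..n}" "?arc i" ?G] arc_subset[OF n0] by auto
  qed simp
  also have "\<dots> = fact n * (m * card ?G)" by simp
  finally show ?thesis by simp
qed

subsection \<open>Shifting down the levels\<close>

text \<open>The ratio of the two coefficients is \<open>(n - i) / (i + 1)\<close>, at least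
  \<open>(k + 1) / k\<close> as long as level \<open>i + 1\<close> is at most
  \<open>k * n / (2 * k + 1)\<close>.\<close>

lemma binomial_step:
  assumes "(2 * k + 1) * Suc i \<le> k * n"
  shows "(k + 1) * (n choose i) \<le> k * (n choose Suc i)"
proof -
  have "i \<le> n"
  proof -
    have "(2 * k + 1) * Suc i \<le> (2 * k + 1) * n" using assms by (simp add: algebra_simps)
    then show ?thesis by (simp only: mult_le_cancel1) simp
  qed
  then obtain d where d: "n = i + d" using le_Suc_ex by blast
  have "(k + 1) * Suc i \<le> k * d" using assms by (simp add: d algebra_simps)
  then have "(k + 1) * Suc i * (n choose i) \<le> k * d * (n choose i)" by (rule mult_right_mono) simp
  also have "d * (n choose i) = Suc i * (n choose Suc i)"
    using d by (metis binomial_absorb_comp binomial_absorption diff_add_inverse)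
  then have "k * d * (n choose i) = k * (Suc i * (n choose Suc i))" by (simp add: mult.assoc)
  finally have "Suc i * ((k + 1) * (n choose i)) \<le> Suc i * (k * (n choose Suc i))"
    by (simp only: ac_simps)
  then show ?thesis by (simp only: Suc_mult_le_cancel1)
qed

lemma binomial_shift:
  assumes "(2 * k + 1) * (i + c) \<le> k * n"
  shows "real (n choose i) \<le> (real k / (real k + 1)) ^ c * real (n choose (i + c))"
  using assms
proof (induction c)
  case (Suc c)
  have "real ((k + 1) * (n choose (i + c))) \<le> real (k * (n choose Suc (i + c)))"
    using Suc.prems by (intro of_nat_mono binomial_step) simp
  then have "real (n choose (i + c)) \<le> real k / (real k + 1) * real (n choose Suc (i + c))"
    by (simp add: field_simps)
  then have "(real k / (real k + 1)) ^ c * real (n choose (i + c))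
      \<le> (real k / (real k + 1)) ^ c * (real k / (real k + 1) * real (n choose Suc (i + c)))"
    by (rule mult_left_mono) simp
  moreover have "real (n choose i) \<le> (real k / (real k + 1)) ^ c * real (n choose (i + c))"
    using Suc by simp
  ultimately show ?case by (simp add: mult_ac)
qed simp

text \<open>By \<open>1 - x \<le> exp (- x)\<close> at \<open>x = 1 / (k + 1)\<close>, the power is
  at most \<open>exp (- 2 * ln (2 * k)) = 1 / (2 * k)^2\<close>, and
  \<open>2 * k + 1 \<le> 4 * k^2\<close> for \<open>k \<ge> 1\<close>.\<close>

lemma shift_factor_le:
  assumes k: "k \<ge> 1" and c: "2 * (real k + 1) * ln (2 * real k) \<le> real c"
  shows "(real k / (real k + 1)) ^ c \<le> 1 / (2 * real k + 1)"
proof -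
  have "real k / (real k + 1) = 1 + (- (1 / (real k + 1)))" by (simp add: field_simps)
  also have "\<dots> \<le> exp (- (1 / (real k + 1)))" by (rule exp_ge_add_one_self)
  finally have "(real k / (real k + 1)) ^ c \<le> exp (- (1 / (real k + 1))) ^ c"
    by (rule power_mono) simp
  also have "\<dots> = exp (- (real c / (real k + 1)))"
    by (simp flip: exp_of_nat_mult)
  also have "\<dots> \<le> exp (- (2 * ln (2 * real k)))" using c by (simp add: field_simps)
  also have "\<dots> = 1 / (2 * real k)\<^sup>2"
    using k by (simp add: exp_minus exp_double field_simps)
  also have "\<dots> \<le> 1 / (2 * real k + 1)"
  proof -
    have "real k * 1 \<le> real k * real k" using k by (intro mult_left_mono) auto
    then have "2 * real k + 1 \<le> 4 * (real k * real k)" using k by linarith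
    then have "2 * real k + 1 \<le> (2 * real k)\<^sup>2" by (simp add: power2_eq_square)
    then show ?thesis using k by (intro divide_left_mono) auto
  qed
  finally show ?thesis .
qed

lemma sum_card_levels_le:
  assumes "finite H" "finite I"
  shows "(\<Sum>a\<in>I. card {S \<in> H. card S = a}) \<le> card H"
proof -
  have "(\<Sum>a\<in>I. card {S \<in> H. card S = a}) = card (\<Union>a\<in>I. {S \<in> H. card S = a})"
    using assms by (intro card_UN_disjoint[symmetric]) auto
  also have "\<dots> \<le> card H" using assms(1) by (intro card_mono) auto
  finally show ?thesis .
qed

text \<open>Ensures that the number of levels in the shift, at least
  \<open>2 * (k + 1) * ln 2\<close>, is at least \<open>k + 1\<close>.\<close>

lemma half_le_ln2: "1 / 2 \<le> ln (2::real)"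
proof -
  have "exp (1 / 2 :: real) \<le> 2" using exp_bound_half[of "1 / 2 :: real"] by simp
  then show ?thesis by (simp only: ln_ge_iff)
qed

subsection \<open>Extremal families\<close>

lemma vex_attained:
  assumes "verts G \<noteq> {}"
  obtains \<F> where "\<F> \<subseteq> Pow {1..n}" "card \<F> = vex n G"
    "\<not> contains_copy (induced_subgraph (kneser_cube n) \<F>) G"
  using Max_in[OF finite_vex_set vex_set_nonempty[OF assms], of n] that
  unfolding vex_def by auto

lemma card_le_vex:
  assumes "\<F> \<subseteq> Pow {1..n}" "\<not> contains_copy (induced_subgraph (kneser_cube n) \<F>) G"
  shows "card \<F> \<le> vex n G"
  unfolding vex_def by (rule Max_ge[OF finite_vex_set]) (use assms in blast)

lemma card_family_plus_complement:
  assumes "\<F> \<subseteq> Pow {1..n}"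
  shows "card \<F> + card (Pow {1..n} - \<F>) = 2 ^ n"
proof -
  have "card (\<F> \<union> (Pow {1..n} - \<F>)) = card \<F> + card (Pow {1..n} - \<F>)"
    using assms by (intro card_Un_disjoint) (auto intro: finite_subset)
  then show ?thesis using assms by (simp add: Un_absorb1 card_Pow)
qed

text \<open>Each level \<open>i\<close> below the cut is charged to level \<open>i + c\<close>,
  where the sets missing from \<open>\<F>\<close> number at least
  \<open>(n choose (i + c)) / m\<close>, hence at least \<open>n choose i\<close>. Distinct
  \<open>i\<close> use distinct levels, so the charges add up.\<close>

lemma cycle_free_card_le:
  fixes k n :: nat
  assumes k: "k \<ge> 1" and F: "\<F> \<subseteq> Pow {1..n}"
    and free: "\<not> contains_copy (induced_subgraph (kneser_cube n) \<F>) (cycle_graph (2 * k + 1))"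
  shows "card \<F> \<le> (\<Sum>i | i \<le> n \<and>
      \<lceil>real k * real n / (2 * real k + 1)\<rceil> - \<lceil>2 * (real k + 1) * ln (2 * real k)\<rceil> \<le> int i.
      n choose i)"
proof -
  define t where "t = \<lceil>real k * real n / (2 * real k + 1)\<rceil> - \<lceil>2 * (real k + 1) * ln (2 * real k)\<rceil>"
  define c where "c = nat \<lceil>2 * (real k + 1) * ln (2 * real k)\<rceil>"
  let ?m = "2 * k + 1"
  let ?co = "Pow {1..n} - \<F>"
  let ?I = "{i. i \<le> n \<and> int i < t}"
  have ln: "1 / 2 \<le> ln (2 * real k)"
    using k by (intro order_trans[OF half_le_ln2]) simp
  then have "2 * (real k + 1) * (1 / 2) \<le> 2 * (real k + 1) * ln (2 * real k)"
    by (intro mult_left_mono) auto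
  moreover have "2 * (real k + 1) * (1 / 2) = real k + 1" by simp
  ultimately have big: "real k + 1 \<le> 2 * (real k + 1) * ln (2 * real k)" by (simp only:)
  \<comment> \<open>This makes \<open>i + c\<close> a positive level and, together with
    \<open>(i + c) * ?m < k * n\<close>, forces \<open>?m \<le> n\<close>;
    \<open>cycle_free_misses_level\<close> requires both.\<close>
  then have ck: "k + 1 \<le> c" unfolding c_def by linarith
  have c_real: "2 * (real k + 1) * ln (2 * real k) \<le> real c" unfolding c_def by linarith
  have c_int: "\<lceil>2 * (real k + 1) * ln (2 * real k)\<rceil> = int c" using ck unfolding c_def by linarith
  have level: "n choose i \<le> card {S \<in> ?co. card S = i + c}" if "i \<in> ?I" for i
  proof -
    have "int i + int c < \<lceil>real k * real n / (2 * real k + 1)\<rceil>" using that c_int by (simp add: t_def)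
    \<comment> \<open>An integer strictly below a ceiling is strictly below the number
      itself.\<close>
    then have "real (i + c) < real k * real n / (2 * real k + 1)" by (simp add: less_ceiling_iff)
    then have "real ((i + c) * ?m) < real (k * n)" by (simp add: field_simps)
    then have lt: "(i + c) * ?m < k * n" by (simp only: of_nat_less_iff)
    then have T: "i + c \<le> k * n div ?m" by (simp add: less_eq_div_iff_mult_less_eq)
    have "k * ?m \<le> (i + c) * ?m" using ck by (intro mult_right_mono) auto
    with lt have "k * ?m < k * n" by linarith
    then have "?m \<le> n" using mult_less_cancel1 less_imp_le by blast
    then have "n choose (i + c) \<le> ?m * card {S \<in> ?co. card S = i + c}"
      using k F free T ck by (intro cycle_free_misses_level) auto
    moreover have "real (n choose i) \<le> 1 / (2 * real k + 1) * real (n choose (i + c))"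
      using binomial_shift[of k i c n] lt shift_factor_le[OF k c_real]
      by (smt (verit, best) less_imp_le mult.commute mult_right_mono of_nat_0_le_iff)
    then have "real (?m * (n choose i)) \<le> real (n choose (i + c))" by (simp add: field_simps)
    then have "?m * (n choose i) \<le> n choose (i + c)" by (simp only: of_nat_le_iff)
    ultimately have "?m * (n choose i) \<le> ?m * card {S \<in> ?co. card S = i + c}" by linarith
    then show ?thesis by (simp only: mult_le_cancel1)
  qed
  have "(\<Sum>i\<in>?I. n choose i) \<le> (\<Sum>i\<in>?I. card {S \<in> ?co. card S = i + c})"
    by (rule sum_mono) (rule level)
  also have "\<dots> = (\<Sum>a\<in>(\<lambda>i. i + c) ` ?I. card {S \<in> ?co. card S = a})"
    by (subst sum.reindex) (auto simp: inj_on_def)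
  also have "\<dots> \<le> card ?co" by (rule sum_card_levels_le) auto
  finally have lower: "(\<Sum>i\<in>?I. n choose i) \<le> card ?co" .
  have "(\<Sum>i\<le>n. n choose i) = (\<Sum>i\<in>?I \<union> {i. i \<le> n \<and> t \<le> int i}. n choose i)"
    by (rule sum.cong) auto
  also have "\<dots> = (\<Sum>i\<in>?I. n choose i) + (\<Sum>i | i \<le> n \<and> t \<le> int i. n choose i)"
    by (rule sum.union_disjoint) auto
  finally have "2 ^ n = (\<Sum>i\<in>?I. n choose i) + (\<Sum>i | i \<le> n \<and> t \<le> int i. n choose i)"
    by (simp add: choose_row_sum)
  with lower card_family_plus_complement[OF F] show ?thesis by (simp add: t_def)
qed

lemma vex_odd_cycle_lower:
  "2 ^ n \<le> vex n (cycle_graph (2 * k + 1)) + (\<Sum>i = 0..k * n div (2 * k + 1). n choose i)"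
proof -
  let ?m = "2 * k + 1"
  define \<F> where "\<F> = {S \<in> Pow {1..n}. k * n div ?m < card S}"
  have F: "\<F> \<subseteq> Pow {1..n}" by (auto simp: \<F>_def)
  have "\<not> contains_copy (induced_subgraph (kneser_cube n) \<F>) (cycle_graph ?m)"
  proof
    assume "contains_copy (induced_subgraph (kneser_cube n) \<F>) (cycle_graph ?m)"
    then obtain f where "\<And>i. i < ?m \<Longrightarrow> f i \<in> \<F>" "\<And>i. i < ?m \<Longrightarrow> f i \<subseteq> {1..n}"
      "\<And>i. i < ?m \<Longrightarrow> f i \<inter> f ((i + 1) mod ?m) = {}"
      by (rule contains_copy_cycleE) blast
    with odd_cycle_has_small_set[of k f n] show False by (force simp: \<F>_def)
  qed
  then have "card \<F> \<le> vex n (cycle_graph ?m)" using F by (rule card_le_vex[rotated])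
  moreover have "card (Pow {1..n} - \<F>) \<le> (\<Sum>i = 0..k * n div ?m. n choose i)"
  proof -
    have "Pow {1..n} - \<F> = (\<Union>i\<in>{0..k * n div ?m}. {S. S \<subseteq> {1..n} \<and> card S = i})"
      by (auto simp: \<F>_def)
    also have "card \<dots> \<le> (\<Sum>i = 0..k * n div ?m. card {S. S \<subseteq> {1..n} \<and> card S = i})"
      by (rule card_UN_le) simp
    finally show ?thesis using n_subsets[of "{1..n}"] by simp
  qed
  ultimately show ?thesis using card_family_plus_complement[OF F] by linarith
qed

text \<open>Here the levels are compared without a shift: the loss \<open>2 * k + 1\<close> at each
  level is constant for fixed \<open>k\<close>, which suffices for the asymptotic claim.\<close>

lemma cycle_free_complement_lower:
  fixes k n :: nat
  assumes k: "k \<ge> 1" and n: "2 * k + 1 \<le> n" and F: "\<F> \<subseteq> Pow {1..n}"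
    and free: "\<not> contains_copy (induced_subgraph (kneser_cube n) \<F>) (cycle_graph (2 * k + 1))"
  shows "(\<Sum>i = 0..k * n div (2 * k + 1). n choose i)
    \<le> 2 * (2 * k + 1) * card (Pow {1..n} - \<F>)"
proof -
  let ?m = "2 * k + 1"
  let ?T = "k * n div ?m"
  have "?m * 1 \<le> k * n" using k n mult_le_mono[of 1 k ?m n] by simp
  then have T: "1 \<le> ?T" by (simp only: less_eq_div_iff_mult_less_eq mult.commute)
  have "(\<Sum>a\<in>{1..?T}. n choose a) \<le> (\<Sum>a\<in>{1..?T}. ?m * card {S \<in> Pow {1..n} - \<F>. card S = a})"
    using assms by (intro sum_mono cycle_free_misses_level) auto
  also have "\<dots> = ?m * (\<Sum>a\<in>{1..?T}. card {S \<in> Pow {1..n} - \<F>. card S = a})"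
    by (simp only: sum_distrib_left)
  also have "\<dots> \<le> ?m * card (Pow {1..n} - \<F>)"
    by (intro mult_left_mono sum_card_levels_le) auto
  finally have upper: "(\<Sum>a\<in>{1..?T}. n choose a) \<le> ?m * card (Pow {1..n} - \<F>)" .
  \<comment> \<open>Level 0 is not reached by \<open>cycle_free_misses_level\<close>. Its single set
    is absorbed by the sum over the positive levels, which is at least 1; this doubles the
    constant.\<close>
  have "n choose 1 \<le> (\<Sum>a\<in>{1..?T}. n choose a)"
    using T by (intro member_le_sum) auto
  then have "1 \<le> (\<Sum>a\<in>{1..?T}. n choose a)" using n by simp
  moreover have "(\<Sum>i = 0..?T. n choose i) = 1 + (\<Sum>a\<in>{1..?T}. n choose a)"
    by (simp add: sum.atLeast_Suc_atMost)
  ultimately show ?thesis using upper by linarith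
qed

theorem theorem4:
  fixes k :: nat
  assumes "k \<ge> 1"
  shows "(\<forall>n::nat. vex n (cycle_graph (2 * k + 1)) \<le>
            (\<Sum>i | i \<le> n \<and>
                \<lceil>real k * real n / (2 * real k + 1)\<rceil> - \<lceil>2 * (real k + 1) * ln (2 * real k)\<rceil> \<le> int i.
              n choose i)) \<and>
         (\<lambda>n::nat. 2 ^ n - real (vex n (cycle_graph (2 * k + 1)))) \<in>
            \<Theta>(\<lambda>n. \<Sum>i = 0..nat \<lfloor>real k * real n / (2 * real k + 1)\<rfloor>. real (n choose i))"
proof (intro conjI allI)
  let ?C = "cycle_graph (2 * k + 1)"
  have ne: "verts ?C \<noteq> {}" by (simp add: cycle_graph_def)
  show "vex n ?C \<le> (\<Sum>i | i \<le> n \<and>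
      \<lceil>real k * real n / (2 * real k + 1)\<rceil> - \<lceil>2 * (real k + 1) * ln (2 * real k)\<rceil> \<le> int i.
      n choose i)" for n
  proof -
    obtain \<F> where F: "\<F> \<subseteq> Pow {1..n}" "card \<F> = vex n ?C"
      "\<not> contains_copy (induced_subgraph (kneser_cube n) \<F>) ?C"
      using vex_attained[OF ne] by blast
    from cycle_free_card_le[OF assms F(1,3)] show ?thesis by (simp only: F(2))
  qed
  let ?g = "\<lambda>n. 2 ^ n - real (vex n ?C)"
  let ?L = "\<lambda>n. \<Sum>i = 0..nat \<lfloor>real k * real n / (2 * real k + 1)\<rfloor>. real (n choose i)"
  have L: "?L n = real (\<Sum>i = 0..k * n div (2 * k + 1). n choose i)" for n
  proof -
    have "\<lfloor>real k * real n / (2 * real k + 1)\<rfloor> = \<lfloor>real (k * n) / real (2 * k + 1)\<rfloor>"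
      by (simp add: add_ac)
    also have "\<dots> = int (k * n div (2 * k + 1))" by (rule floor_divide_of_nat_eq)
    finally show ?thesis by simp
  qed
  \<comment> \<open>For an extremal family, \<open>?g n\<close> is exactly the number of sets it
    misses.\<close>
  have g0: "0 \<le> ?g n" and lower: "2 * k + 1 \<le> n \<Longrightarrow> ?L n \<le> real (2 * (2 * k + 1)) * ?g n" for n
  proof -
    obtain \<F> where F: "\<F> \<subseteq> Pow {1..n}" "card \<F> = vex n ?C"
      "\<not> contains_copy (induced_subgraph (kneser_cube n) \<F>) ?C"
      using vex_attained[OF ne] by blast
    have "real (card \<F> + card (Pow {1..n} - \<F>)) = real (2 ^ n)"
      using card_family_plus_complement[OF F(1)] by (simp only:)
    then have g: "?g n = real (card (Pow {1..n} - \<F>))" using F(2) by simp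
    then show "0 \<le> ?g n" by simp
    assume n: "2 * k + 1 \<le> n"
    have "real (\<Sum>i = 0..k * n div (2 * k + 1). n choose i)
        \<le> real (2 * (2 * k + 1) * card (Pow {1..n} - \<F>))"
      using cycle_free_complement_lower[OF assms n F(1,3)] by (simp only: of_nat_le_iff)
    then show "?L n \<le> real (2 * (2 * k + 1)) * ?g n"
      unfolding L g by (simp only: of_nat_mult)
  qed
  have upper: "?g n \<le> ?L n" for n
  proof -
    have "real (2 ^ n) \<le> real (vex n ?C + (\<Sum>i = 0..k * n div (2 * k + 1). n choose i))"
      using vex_odd_cycle_lower by (simp only: of_nat_le_iff)
    then show ?thesis unfolding L by simp
  qed
  have L0: "0 \<le> ?L n" for n by (rule sum_nonneg) simp
  have "?g \<in> O(?L)"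
    using g0 upper by (intro bigoI[where c = 1] always_eventually) (simp add: abs_of_nonneg[OF L0])
  moreover have "?L \<in> O(?g)"
  \<comment> \<open>The constant is that of \<open>cycle_free_complement_lower\<close>, valid once
    \<open>n \<ge> 2 * k + 1\<close>.\<close>
  proof (rule bigoI[where c = "real (2 * (2 * k + 1))"])
    show "\<forall>\<^sub>F n in sequentially. norm (?L n) \<le> real (2 * (2 * k + 1)) * norm (?g n)"
      using eventually_ge_at_top[of "2 * k + 1"]
    proof eventually_elim
      case (elim n)
      then show ?case using lower[OF elim] g0[of n] L0[of n] by (simp only: real_norm_def abs_of_nonneg)
    qed
  qed
  ultimately show "?g \<in> \<Theta>(?L)" by (simp add: bigtheta_def bigomega_iff_bigo)
qed

end
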